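(* Let $X=(X,d)$ be a complete separable metric space and let $a<b$ be real numbers. Let $\gamma:[a,b]\to X$ be a Borel map such that $[h\circ\gamma]\cap C([a,b])\neq\emptyset$ for every Lipschitz function $h:X\to\mathbb{R}$. Then $[\gamma]\cap C([a,b],X)\neq\emptyset$.
   Context: For a metric space $Y$ and a Borel map $f:[a,b]\to Y$, $[f]$ denotes the equivalence class of $f$ up to $\mathcal{L}^1$-a.e. equality: $[f]:=\{\widetilde f:[a,b]\to Y:\ \mathcal{L}^1(\{t\in[a,b]:\widetilde f(t)\ne f(t)\})=0\}$, where $\mathcal{L}^1$ is Lebesgue measure. $C([a,b],Y)$ is the set of continuous maps from $[a,b]$ to $Y$ and $C([a,b]):=C([a,b],\mathbb{R})$. *)

theory Defs
  imports "HOL-Analysis.Analysis"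
begin

text \<open>
  A map on \<open>[a,b]\<close> is represented by a total function on the reals whose values outside
  \<open>{a..b}\<close> are irrelevant.
\<close>

text \<open>
  A representative is an arbitrary, not necessarily measurable function. The exceptional set
  is therefore required to be a null set of the complete Lebesgue measure; the condition
  \<open>emeasure lborel N = 0\<close> would hold trivially for non-measurable \<open>N\<close>.
\<close>

definition ae_class :: "real \<Rightarrow> real \<Rightarrow> (real \<Rightarrow> 'a) \<Rightarrow> (real \<Rightarrow> 'a) set" where
  "ae_class a b f = {g. {t \<in> {a..b}. g t \<noteq> f t} \<in> null_sets lebesgue}"

definition continuous_maps :: "real \<Rightarrow> real \<Rightarrow> (real \<Rightarrow> 'a::topological_space) set" where
  "continuous_maps a b = {f. continuous_on {a..b} f}"

end

theory Submission imports Defs begin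

text \<open>
  A sequence in a complete metric space converges as soon as its image under every real Lipschitz
  function does (\<open>convergent_if_lipschitz_images_convergent\<close>). The distances to any point then
  converge along the sequence. If the limits come arbitrarily close to \<open>0\<close>, the sequence is Cauchy;
  if not, it contains a uniformly separated subsequence, and the distance to the even-numbered terms
  of that subsequence oscillates.

  The compositions \<open>h \<circ> \<gamma>\<close> are continuous only up to null sets depending on \<open>h\<close>. To control all of
  them at once, fix a countable dense set \<open>P\<close> and, for each \<open>p \<in> P\<close>, a continuous representative
  \<open>g p\<close> of the distance from \<open>\<gamma>\<close> to \<open>p\<close>. By countability, all \<open>g p\<close> coincide with the actual distances
  outside one null set; let \<open>D\<close> be its complement in the interval. The distances to \<open>P\<close> determine the
  topology, so \<open>\<gamma>\<close> is continuous on \<open>D\<close> (\<open>continuous_on_if_dist_to_dense\<close>). Hence, for an arbitrary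
  Lipschitz function \<open>h\<close>, the composition \<open>h \<circ> \<gamma>\<close> agrees with its continuous representative on all of
  \<open>D\<close>, and the convergence criterion applies along any sequence in \<open>D\<close> tending to a point \<open>t\<close> of the
  interval. The limit \<open>y t\<close> satisfies \<open>dist (y t) p = g p t\<close> for \<open>p \<in> P\<close>. Again because distances to
  \<open>P\<close> determine topology and points, \<open>y\<close> is continuous and equals \<open>\<gamma>\<close> on \<open>D\<close>.
\<close>

lemma lipschitz_on_infdist: "1-lipschitz_on UNIV (\<lambda>x. infdist x E)"
  by (rule lipschitz_onI) (auto simp: dist_real_def infdist_triangle_abs)

lemma lipschitz_on_dist:
  fixes p :: "'a::metric_space"
  shows "1-lipschitz_on UNIV (\<lambda>x. dist x p)"
  using lipschitz_on_infdist[of "{p}"] by simp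

text \<open>
  Only finitely many terms have been chosen at each stage, so all sufficiently late terms are far from
  every one of them.
\<close>

lemma separated_subsequence:
  fixes z :: "nat \<Rightarrow> 'a::metric_space"
  assumes far: "\<And>x. \<forall>\<^sub>F n in sequentially. c \<le> dist (z n) x"
  obtains r :: "nat \<Rightarrow> nat" where "strict_mono r"
    and "\<And>i j. i \<noteq> j \<Longrightarrow> c \<le> dist (z (r i)) (z (r j))"
proof -
  let ?P = "\<lambda>r k m. \<forall>i<k. r i < m \<and> c \<le> dist (z m) (z (r i))"
  have "\<exists>r :: nat \<Rightarrow> nat. \<forall>k. ?P r k (r k)"
  proof (rule dependent_wf_choice[OF wf_less])
    fix f :: "nat \<Rightarrow> nat" and k :: nat
    have "\<forall>\<^sub>F m in sequentially. \<forall>i\<in>{..<k}. f i < m \<and> c \<le> dist (z m) (z (f i))"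
      by (intro eventually_ball_finite ballI eventually_conj eventually_gt_at_top far) auto
    then show "\<exists>m. ?P f k m"
      by (auto simp: eventually_sequentially)
  qed auto
  then obtain r :: "nat \<Rightarrow> nat" where r: "\<And>k. ?P r k (r k)"
    by blast
  show thesis
  proof
    show "strict_mono r"
      using r by (auto simp: strict_mono_def)
    show "c \<le> dist (z (r i)) (z (r j))" if "i \<noteq> j" for i j
      using that r by (metis dist_commute linorder_neqE_nat)
  qed
qed

text \<open>
  If for some \<open>c > 0\<close> the distance to every point were eventually at least \<open>c\<close>, there would be a
  \<open>c\<close>-separated subsequence, and the distance to its even-numbered terms would be a Lipschitz function
  alternating between \<open>0\<close> and values at least \<open>c\<close>. So for every \<open>c > 0\<close> some point is infinitely
  often closer than \<open>c\<close> to the sequence. Because the distances to it converge, it then stays nearly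
  that close, which gives the Cauchy property.
\<close>

lemma convergent_if_lipschitz_images_convergent:
  fixes z :: "nat \<Rightarrow> 'a::complete_space"
  assumes conv: "\<And>(h :: 'a \<Rightarrow> real) L. L-lipschitz_on UNIV h \<Longrightarrow> convergent (\<lambda>n. h (z n))"
  shows "convergent z"
proof -
  have no_gap: "\<exists>x. \<not> (\<forall>\<^sub>F n in sequentially. c \<le> dist (z n) x)" if "c > 0" for c
  proof (rule ccontr)
    assume "\<not> ?thesis"
    then obtain r :: "nat \<Rightarrow> nat" where r: "strict_mono r"
      and sep: "\<And>i j. i \<noteq> j \<Longrightarrow> c \<le> dist (z (r i)) (z (r j))"
      by (metis separated_subsequence)
    define E where "E = range (\<lambda>k. z (r (2 * k)))"
    obtain l where l: "(\<lambda>n. infdist (z n) E) \<longlonglongrightarrow> l"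
      using conv[OF lipschitz_on_infdist] by (auto simp: convergent_def)
    have "strict_mono (\<lambda>k. r (2 * k))" "strict_mono (\<lambda>k. r (2 * k + 1))"
      using r by (auto simp: strict_mono_def)
    then have "(\<lambda>k. infdist (z (r (2 * k))) E) \<longlonglongrightarrow> l"
      and odd_lim: "(\<lambda>k. infdist (z (r (2 * k + 1))) E) \<longlonglongrightarrow> l"
      using LIMSEQ_subseq_LIMSEQ[OF l] by (auto simp: o_def)
    moreover have "infdist (z (r (2 * k))) E = 0" for k
      by (rule infdist_zero) (auto simp: E_def)
    ultimately have "l = 0"
      by (simp add: LIMSEQ_const_iff)
    have "c \<le> infdist (z (r (2 * k + 1))) E" for k
    proof -
      have "2 * k + 1 \<noteq> 2 * i" for i :: nat
        by presburger
      then show ?thesis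
        unfolding infdist_def E_def by (auto intro!: cINF_greatest sep)
    qed
    then have "c \<le> l"
      using odd_lim by (meson LIMSEQ_le_const)
    with \<open>l = 0\<close> \<open>c > 0\<close> show False
      by simp
  qed
  have "Cauchy z"
  proof (rule metric_CauchyI)
    fix e :: real assume "e > 0"
    then obtain x where x: "\<not> (\<forall>\<^sub>F n in sequentially. e/4 \<le> dist (z n) x)"
      using no_gap[of "e/4"] by auto
    obtain l where l: "(\<lambda>n. dist (z n) x) \<longlonglongrightarrow> l"
      using conv[OF lipschitz_on_dist] by (auto simp: convergent_def)
    have "l \<le> e/4"
    proof (rule ccontr)
      assume "\<not> l \<le> e/4"
      then have "\<forall>\<^sub>F n in sequentially. e/4 < dist (z n) x"
        by (intro order_tendstoD(1)[OF l]) simp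
      with x show False
        by (meson eventually_mono less_imp_le)
    qed
    then have "\<forall>\<^sub>F n in sequentially. dist (z n) x < e/2"
      using \<open>e > 0\<close> by (intro order_tendstoD(2)[OF l]) simp
    then obtain M where "\<And>n. n \<ge> M \<Longrightarrow> dist (z n) x < e/2"
      by (auto simp: eventually_sequentially)
    then show "\<exists>M. \<forall>m\<ge>M. \<forall>n\<ge>M. dist (z m) (z n) < e"
      by (meson dist_triangle_half_l)
  qed
  then show ?thesis
    by (rule Cauchy_convergent)
qed

text \<open>
  A dense set contains points near \<open>f t\<close>, and being near such a point is controlled by a single one
  of the continuous distance functions.
\<close>

lemma continuous_on_if_dist_to_dense:
  fixes f :: "'b::topological_space \<Rightarrow> 'a::metric_space"
  assumes dense: "\<And>U. open U \<Longrightarrow> U \<noteq> {} \<Longrightarrow> \<exists>p\<in>P. p \<in> U"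
    and cont: "\<And>p. p \<in> P \<Longrightarrow> continuous_on D (\<lambda>t. dist (f t) p)"
  shows "continuous_on D f"
  unfolding continuous_on_def
proof (intro ballI tendstoI)
  fix t and e :: real assume t: "t \<in> D" and "e > 0"
  then obtain p where p: "p \<in> P" "dist (f t) p < e/2"
    using dense[of "ball (f t) (e/2)"] by auto
  have "((\<lambda>s. dist (f s) p) \<longlongrightarrow> dist (f t) p) (at t within D)"
    using cont[OF p(1)] t by (auto simp: continuous_on_def)
  then have "\<forall>\<^sub>F s in at t within D. dist (f s) p < e/2"
    using p(2) by (rule order_tendstoD(2))
  then show "\<forall>\<^sub>F s in at t within D. dist (f s) (f t) < e"
    using p(2) by (auto elim!: eventually_mono intro: dist_triangle_half_l)
qed

lemma eq_if_dist_to_dense_eq: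
  fixes x y :: "'a::metric_space"
  assumes dense: "\<And>U. open U \<Longrightarrow> U \<noteq> {} \<Longrightarrow> \<exists>p\<in>P. p \<in> U"
    and eq: "\<And>p. p \<in> P \<Longrightarrow> dist x p = dist y p"
  shows "x = y"
proof (rule ccontr)
  assume "x \<noteq> y"
  then obtain p where "p \<in> P" "dist x p < dist x y / 2"
    using dense[of "ball x (dist x y / 2)"] by auto
  with eq[of p] show False
    using dist_triangle2[of x y p] by linarith
qed

lemma interval_subset_closure_diff_null:
  fixes a b :: real
  assumes "a < b" and N: "N \<in> null_sets lebesgue"
  shows "{a..b} \<subseteq> closure ({a..b} - N)"
proof -
  have "{a<..<b} \<subseteq> closure ({a<..<b} - N)"
  proof
    fix t assume t: "t \<in> {a<..<b}"
    show "t \<in> closure ({a<..<b} - N)"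
      unfolding closure_iff_nhds_not_empty
    proof (intro allI impI)
      fix A V assume "V \<subseteq> A" "open V" "t \<in> V"
      then have "open (V \<inter> {a<..<b})" "V \<inter> {a<..<b} \<noteq> {}"
        using t by auto
      then have "\<not> negligible (V \<inter> {a<..<b})"
        using open_not_negligible by blast
      then have "\<not> V \<inter> {a<..<b} \<subseteq> N"
        using N negligible_iff_null_sets negligible_subset by blast
      with \<open>V \<subseteq> A\<close> show "({a<..<b} - N) \<inter> A \<noteq> {}"
        by blast
    qed
  qed
  then have "closure {a<..<b} \<subseteq> closure ({a<..<b} - N)"
    by (rule closure_minimal) simp
  also have "\<dots> \<subseteq> closure ({a..b} - N)"
    by (rule closure_mono) auto
  finally show ?thesis
    using \<open>a < b\<close> by simp
qed

theorem theorem1p3: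
  fixes \<gamma> :: "real \<Rightarrow> 'a::polish_space" and a b :: real
  assumes "a < b"
    and "\<gamma> \<in> borel_measurable (restrict_space borel {a..b})"
    and "\<And>(h :: 'a \<Rightarrow> real) L. L-lipschitz_on UNIV h \<Longrightarrow>
           ae_class a b (h \<circ> \<gamma>) \<inter> continuous_maps a b \<noteq> {}"
  shows "ae_class a b \<gamma> \<inter> continuous_maps a b \<noteq> {}"
proof -
  have rep: "\<exists>g. continuous_on {a..b} g \<and> {t \<in> {a..b}. g t \<noteq> h (\<gamma> t)} \<in> null_sets lebesgue"
    if "L-lipschitz_on UNIV h" for h :: "'a \<Rightarrow> real" and L
    using assms(3)[OF that] by (auto simp: ae_class_def continuous_maps_def)
  obtain P :: "'a set" where "countable P"
    and dense: "\<And>U. open U \<Longrightarrow> U \<noteq> {} \<Longrightarrow> \<exists>p\<in>P. p \<in> U"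
    by (rule countable_dense_setE) blast
  have "\<forall>p. \<exists>g. continuous_on {a..b} g \<and>
      {t \<in> {a..b}. g t \<noteq> dist (\<gamma> t) p} \<in> null_sets lebesgue"
    using rep[OF lipschitz_on_dist] by blast
  then obtain g where g_cont: "\<And>p. continuous_on {a..b} (g p)"
    and g_null: "\<And>p. {t \<in> {a..b}. g p t \<noteq> dist (\<gamma> t) p} \<in> null_sets lebesgue"
    by metis
  define N where "N = (\<Union>p\<in>P. {t \<in> {a..b}. g p t \<noteq> dist (\<gamma> t) p})"
  define D where "D = {a..b} - N"
  have N: "N \<in> null_sets lebesgue"
    unfolding N_def using \<open>countable P\<close> g_null by (intro null_sets_UN') auto
  have D_sub: "D \<subseteq> {a..b}"
    by (auto simp: D_def)
  have g_eq: "g p t = dist (\<gamma> t) p" if "p \<in> P" "t \<in> D" for p t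
    using that by (auto simp: D_def N_def)
  have \<gamma>_cont: "continuous_on D \<gamma>"
  proof (rule continuous_on_if_dist_to_dense[OF dense])
    fix p assume "p \<in> P"
    then show "continuous_on D (\<lambda>t. dist (\<gamma> t) p)"
      using continuous_on_subset[OF g_cont D_sub, of p] g_eq by (simp cong: continuous_on_cong)
  qed
  \<comment> \<open>The exceptional set of \<open>h\<close> can be discarded inside \<open>D\<close>: two functions continuous on \<open>D\<close> that
    agree off a null set agree on \<open>D\<close>.\<close>
  have rep_D: "\<exists>k. continuous_on {a..b} k \<and> (\<forall>t\<in>D. k t = h (\<gamma> t))"
    if h: "L-lipschitz_on UNIV h" for h :: "'a \<Rightarrow> real" and L
  proof -
    obtain k where k: "continuous_on {a..b} k"
      and M: "{t \<in> {a..b}. k t \<noteq> h (\<gamma> t)} \<in> null_sets lebesgue" (is "?M \<in> _")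
      using rep[OF h] by blast
    have h\<gamma>: "continuous_on D (\<lambda>t. h (\<gamma> t))"
      using continuous_on_compose2[OF lipschitz_on_continuous_on[OF h] \<gamma>_cont] by simp
    have "k t = h (\<gamma> t)" if t: "t \<in> D" for t
    proof -
      have "t \<in> closure ({a..b} - (N \<union> ?M))"
        using interval_subset_closure_diff_null[OF \<open>a < b\<close>, of "N \<union> ?M"] N M t D_sub by blast
      then obtain s where s: "\<And>n. s n \<in> {a..b} - (N \<union> ?M)" and lim: "s \<longlonglongrightarrow> t"
        unfolding closure_sequential by blast
      have sD: "s n \<in> D" and s_eq: "k (s n) = h (\<gamma> (s n))" for n
        using s[of n] by (auto simp: D_def)
      have "(\<lambda>n. h (\<gamma> (s n))) \<longlonglongrightarrow> h (\<gamma> t)"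
        using continuous_on_tendsto_compose[OF h\<gamma> lim t] sD by simp
      moreover have "(\<lambda>n. k (s n)) \<longlonglongrightarrow> k t"
        using continuous_on_tendsto_compose[OF k lim] t sD D_sub by (simp add: subset_iff)
      ultimately show ?thesis
        using s_eq LIMSEQ_unique by simp
    qed
    with k show ?thesis
      by blast
  qed
  have "\<exists>x. \<forall>p\<in>P. dist x p = g p t" if t: "t \<in> {a..b}" for t
  proof -
    have "t \<in> closure D"
      using interval_subset_closure_diff_null[OF \<open>a < b\<close> N] t by (auto simp: D_def)
    then obtain s where s: "\<And>n. s n \<in> D" and lim: "s \<longlonglongrightarrow> t"
      unfolding closure_sequential by blast
    have s_ab: "s n \<in> {a..b}" for n
      using s D_sub by blast
    have "convergent (\<lambda>n. \<gamma> (s n))"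
    proof (rule convergent_if_lipschitz_images_convergent)
      fix h :: "'a \<Rightarrow> real" and L assume "L-lipschitz_on UNIV h"
      then obtain k where k: "continuous_on {a..b} k" "\<forall>t\<in>D. k t = h (\<gamma> t)"
        using rep_D by blast
      have "(\<lambda>n. k (s n)) \<longlonglongrightarrow> k t"
        using continuous_on_tendsto_compose[OF k(1) lim t] s_ab by simp
      then show "convergent (\<lambda>n. h (\<gamma> (s n)))"
        using k(2) s by (auto simp: convergent_def)
    qed
    then obtain x where x: "(\<lambda>n. \<gamma> (s n)) \<longlonglongrightarrow> x"
      by (auto simp: convergent_def)
    have "dist x p = g p t" if "p \<in> P" for p
    proof -
      have "(\<lambda>n. dist (\<gamma> (s n)) p) \<longlonglongrightarrow> dist x p"
        by (intro tendsto_intros x)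
      moreover have "(\<lambda>n. g p (s n)) \<longlonglongrightarrow> g p t"
        using continuous_on_tendsto_compose[OF g_cont lim t] s_ab by simp
      ultimately show ?thesis
        using g_eq[OF that s] LIMSEQ_unique by simp
    qed
    then show ?thesis
      by blast
  qed
  then obtain y where y: "\<And>t p. t \<in> {a..b} \<Longrightarrow> p \<in> P \<Longrightarrow> dist (y t) p = g p t"
    by metis
  have "continuous_on {a..b} y"
  proof (rule continuous_on_if_dist_to_dense[OF dense])
    fix p assume "p \<in> P"
    show "continuous_on {a..b} (\<lambda>t. dist (y t) p)"
      by (rule continuous_on_eq[OF g_cont]) (simp add: y \<open>p \<in> P\<close>)
  qed
  moreover have "y t = \<gamma> t" if "t \<in> D" for t
    using that D_sub y g_eq by (intro eq_if_dist_to_dense_eq[OF dense]) (auto simp: subset_iff)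
  then have "{t \<in> {a..b}. y t \<noteq> \<gamma> t} \<subseteq> N"
    by (auto simp: D_def)
  then have "{t \<in> {a..b}. y t \<noteq> \<gamma> t} \<in> null_sets lebesgue"
    using N negligible_iff_null_sets negligible_subset by blast
  ultimately show ?thesis
    by (auto simp: ae_class_def continuous_maps_def)
qed

end
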